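(* Let $0\le\alpha<1$ and let $p\ge q\ge2$ and $n$ be integers with $p+q\le n-1$. Then $\lambda_\alpha(B^6_{n,p,q})\ge\lambda_\alpha(B^5_{n,p,q})$, with equality if and only if $p=q$ or $\alpha=0$.
   Context: All digraphs are simple. For a digraph $G$, $A(G)$ is its adjacency matrix and $D(G)$ the diagonal matrix of outdegrees; $A_\alpha(G)=\alpha D(G)+(1-\alpha)A(G)$ and $\lambda_\alpha(G)$ is the largest modulus of an eigenvalue of $A_\alpha(G)$. $\overleftrightarrow{K_{p,q}}$ is the complete bipartite digraph obtained from $K_{p,q}$ by replacing each edge with a pair of opposite arcs, with parts $V_p=\{v_1,\ldots,v_p\}$ and $V_q=\{v_{p+1},\ldots,v_{p+q}\}$; let $v_{p+q+1},\ldots,v_n$ be new vertices. $B^5_{n,p,q}$ is obtained from $\overleftrightarrow{K_{p,q}}$ by adding the directed path $v_1v_{p+q+1}v_{p+q+2}\cdots v_nv_{p+1}$; $B^6_{n,p,q}$ is obtained by adding the directed path $v_{p+1}v_{p+q+1}v_{p+q+2}\cdots v_nv_1$. *)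

theory Defs
  imports "Graph_Theory.Graph_Theory" "Jordan_Normal_Form.Spectral_Radius"
begin

(* A digraph of order n is taken to have vertex set {1..n}; vertex v_i is the number i.
   Rows and columns of the matrices below are indexed from 0, so row i belongs to
   vertex Suc i. *)

definition adjacency_matrix :: "nat pair_pre_digraph \<Rightarrow> complex mat" where
  "adjacency_matrix G = mat (card (pverts G)) (card (pverts G))
     (\<lambda>(i, j). if (Suc i, Suc j) \<in> parcs G then 1 else 0)"

definition outdegree_matrix :: "nat pair_pre_digraph \<Rightarrow> complex mat" where
  "outdegree_matrix G = mat (card (pverts G)) (card (pverts G))
     (\<lambda>(i, j). if i = j then of_nat (out_degree (with_proj G) (Suc i)) else 0)"

definition A_alpha :: "real \<Rightarrow> nat pair_pre_digraph \<Rightarrow> complex mat" where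
  "A_alpha \<alpha> G = complex_of_real \<alpha> \<cdot>\<^sub>m outdegree_matrix G
     + complex_of_real (1 - \<alpha>) \<cdot>\<^sub>m adjacency_matrix G"

definition lambda_alpha :: "real \<Rightarrow> nat pair_pre_digraph \<Rightarrow> real" where
  "lambda_alpha \<alpha> G = spectral_radius (A_alpha \<alpha> G)"

definition complete_bipartite_digraph :: "nat \<Rightarrow> nat \<Rightarrow> nat pair_pre_digraph" where
  "complete_bipartite_digraph p q =
     \<lparr> pverts = {1..p + q},
       parcs = {1..p} \<times> {p + 1..p + q} \<union> {p + 1..p + q} \<times> {1..p} \<rparr>"

definition add_directed_path :: "'a pair_pre_digraph \<Rightarrow> 'a list \<Rightarrow> 'a pair_pre_digraph" where
  "add_directed_path G vs =
     \<lparr> pverts = pverts G \<union> set vs, parcs = parcs G \<union> set (vwalk_arcs vs) \<rparr>"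

definition B5 :: "nat \<Rightarrow> nat \<Rightarrow> nat \<Rightarrow> nat pair_pre_digraph" where
  "B5 n p q = add_directed_path (complete_bipartite_digraph p q)
     ([1] @ [p + q + 1..<n + 1] @ [p + 1])"

definition B6 :: "nat \<Rightarrow> nat \<Rightarrow> nat \<Rightarrow> nat pair_pre_digraph" where
  "B6 n p q = add_directed_path (complete_bipartite_digraph p q)
     ([p + 1] @ [p + q + 1..<n + 1] @ [1])"

lemma pverts_B5:
  assumes "1 \<le> p" "1 \<le> q" "p + q \<le> n" shows "pverts (B5 n p q) = {1..n}"
  using assms by (auto simp: B5_def add_directed_path_def complete_bipartite_digraph_def)

lemma pverts_B6:
  assumes "1 \<le> p" "1 \<le> q" "p + q \<le> n" shows "pverts (B6 n p q) = {1..n}"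
  using assms by (auto simp: B6_def add_directed_path_def complete_bipartite_digraph_def)

lemma vwalk_arcs_endpoints:
  assumes "e \<in> set (vwalk_arcs vs)" shows "fst e \<in> set vs" "snd e \<in> set vs"
  using assms by (induction vs rule: vwalk_arcs.induct) auto

lemma vwalk_arcs_distinct_ends:
  assumes "successively (\<noteq>) vs" "e \<in> set (vwalk_arcs vs)" shows "fst e \<noteq> snd e"
  using assms by (induction vs rule: vwalk_arcs.induct) auto

lemma successively_neq_distinct: "distinct vs \<Longrightarrow> successively (\<noteq>) vs"
  by (induction vs rule: vwalk_arcs.induct) auto

lemma pair_digraph_add_directed_path:
  assumes "finite (pverts G)" "finite (parcs G)" "parcs G \<subseteq> pverts G \<times> pverts G"
    and "\<And>v. (v, v) \<notin> parcs G" and "distinct vs"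
  shows "pair_digraph (add_directed_path G vs)"
proof
  fix e assume "e \<in> parcs (add_directed_path G vs)"
  then have e: "e \<in> parcs G \<or> e \<in> set (vwalk_arcs vs)"
    by (simp add: add_directed_path_def)
  show "fst e \<in> pverts (add_directed_path G vs)" "snd e \<in> pverts (add_directed_path G vs)"
    using e assms(3) vwalk_arcs_endpoints[of e vs] by (auto simp: add_directed_path_def)
  show "fst e \<noteq> snd e"
    using e assms(4) vwalk_arcs_distinct_ends[OF successively_neq_distinct[OF assms(5)]]
    by (metis prod.collapse)
qed (use assms in \<open>auto simp: add_directed_path_def\<close>)

lemma pair_digraph_B5: "1 \<le> p \<Longrightarrow> 1 \<le> q \<Longrightarrow> pair_digraph (B5 n p q)"
  unfolding B5_def
  by (rule pair_digraph_add_directed_path) (auto simp: complete_bipartite_digraph_def)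

lemma pair_digraph_B6: "1 \<le> p \<Longrightarrow> 1 \<le> q \<Longrightarrow> pair_digraph (B6 n p q)"
  unfolding B6_def
  by (rule pair_digraph_add_directed_path) (auto simp: complete_bipartite_digraph_def)

end

theory Submission
  imports Defs
begin

text \<open>A nonnegative matrix with a positive eigenvector has the corresponding eigenvalue as its
  spectral radius. On both digraphs an eigenvector can be written down explicitly: along the path
  it is a geometric sequence, and it takes two values on the part where the path starts and one
  value on the other part. Its eigenvalue \<open>\<mu>\<close> is then characterised by a scalar equation.
  Exchanging \<open>p\<close> and \<open>q\<close> turns the equation of \<open>B\<^sup>5\<close> into that of \<open>B\<^sup>6\<close>, and the two differ only
  through a term \<open>\<alpha> (s + c) / (\<mu> - \<alpha> (s + 1))\<close>, with \<open>s = q\<close> and \<open>s = p\<close> respectively, which is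
  strictly increasing in \<open>s\<close> when \<open>\<alpha> > 0\<close>. So for \<open>p > q\<close> the characteristic function of
  \<open>B\<^sup>6\<close> is still negative at the root for \<open>B\<^sup>5\<close> and has a larger root.\<close>

section \<open>Rows of the matrix and spectral radius from a positive eigenvector\<close>

lemma out_degree_with_proj_eq_card: "out_degree (with_proj G) v = card {w. (v, w) \<in> parcs G}"
proof -
  have "out_arcs (with_proj G) v = Pair v ` {w. (v, w) \<in> parcs G}"
    by (auto simp: out_arcs_def)
  then show ?thesis
    by (simp add: out_degree_def card_image inj_on_def)
qed

lemma pair_digraph_successor_in_verts:
  assumes "pair_digraph G" "(u, v) \<in> parcs G" shows "v \<in> pverts G"
proof -
  have "pair_wf_digraph G"
    using assms(1) by (simp add: pair_digraph_def pair_fin_digraph_def)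
  then show ?thesis using assms(2) by (rule pair_wf_digraph.in_arcsD2)
qed

text \<open>The diagonal entry counts the out-neighbours, so its contribution can be spread over
  them, one \<open>\<alpha> * w (Suc i)\<close> per arc. Each row then becomes a single sum over
  arcs.\<close>

lemma A_alpha_mult_vec_index:
  assumes G: "pair_digraph G" and V: "pverts G = {1..n}" and i: "i < n"
  shows "(A_alpha \<alpha> G *\<^sub>v vec n (\<lambda>j. w (Suc j))) $ i =
    (\<Sum>j | (Suc i, j) \<in> parcs G. of_real \<alpha> * w (Suc i) + of_real (1 - \<alpha>) * w j)"
proof -
  let ?N = "{j. (Suc i, j) \<in> parcs G}"
  have N: "?N \<subseteq> {1..n}" using V pair_digraph_successor_in_verts[OF G] by auto
  have N': "?N = Suc ` {j \<in> {0..<n}. (Suc i, Suc j) \<in> parcs G}"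
  proof -
    have "x \<in> Suc ` {j \<in> {0..<n}. (Suc i, Suc j) \<in> parcs G}" if "x \<in> ?N" for x
    proof -
      have "x \<in> {1..n}" using that N by blast
      then show ?thesis using that by (intro image_eqI[of _ _ "x - 1"]) auto
    qed
    then show ?thesis by auto
  qed
  have "(A_alpha \<alpha> G *\<^sub>v vec n (\<lambda>j. w (Suc j))) $ i =
    (\<Sum>j = 0..<n. (of_real \<alpha> * (if i = j then of_nat (card ?N) else 0)
       + of_real (1 - \<alpha>) * (if (Suc i, Suc j) \<in> parcs G then 1 else 0)) * w (Suc j))"
    unfolding A_alpha_def adjacency_matrix_def outdegree_matrix_def out_degree_with_proj_eq_card
    using V i by (simp add: scalar_prod_def)
  also have "\<dots> = (\<Sum>j = 0..<n. (if i = j then of_real \<alpha> * of_nat (card ?N) * w (Suc j) else 0))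
      + (\<Sum>j = 0..<n. if (Suc i, Suc j) \<in> parcs G then of_real (1 - \<alpha>) * w (Suc j) else 0)"
    unfolding sum.distrib[symmetric] by (intro sum.cong) (auto simp: algebra_simps)
  also have "(\<Sum>j = 0..<n. if i = j then of_real \<alpha> * of_nat (card ?N) * w (Suc j) else 0)
      = (\<Sum>j\<in>?N. of_real \<alpha> * w (Suc i))"
    using i by (simp add: algebra_simps)
  also have "(\<Sum>j = 0..<n. if (Suc i, Suc j) \<in> parcs G then of_real (1 - \<alpha>) * w (Suc j) else 0)
      = (\<Sum>j\<in>?N. of_real (1 - \<alpha>) * w j)"
    unfolding N' by (subst sum.reindex)
      (simp_all only: sum.inter_filter finite_atLeastLessThan o_def inj_Suc)
  finally show ?thesis by (simp add: sum.distrib)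
qed

text \<open>Comparing an arbitrary eigenvector with the positive one at the vertex where the quotient
  of the moduli is largest bounds every eigenvalue by the one of the positive eigenvector.\<close>

lemma lambda_alpha_eqI:
  assumes G: "pair_digraph G" and V: "pverts G = {1..n}" and n: "0 < n"
    and \<alpha>: "0 \<le> \<alpha>" "\<alpha> \<le> 1"
    and pos: "\<And>i. i \<in> {1..n} \<Longrightarrow> 0 < h i"
    and eig: "\<And>i. i \<in> {1..n} \<Longrightarrow>
      (\<Sum>j | (i, j) \<in> parcs G. \<alpha> * h i + (1 - \<alpha>) * h j) = \<mu> * h i"
  shows "lambda_alpha \<alpha> G = \<mu>"
proof -
  let ?A = "A_alpha \<alpha> G"
  have A: "?A \<in> carrier_mat n n"
    using V by (simp add: A_alpha_def adjacency_matrix_def outdegree_matrix_def)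
  have N: "{j. (i, j) \<in> parcs G} \<subseteq> {1..n}" for i
    using V pair_digraph_successor_in_verts[OF G] by auto
  \<comment> \<open>The eigenvalue equation at vertex 1 gives \<open>0 \<le> \<mu>\<close>, so that
    the modulus of \<open>\<mu>\<close> is \<open>\<mu>\<close> itself.\<close>
  have "0 \<le> (\<Sum>j | (1, j) \<in> parcs G. \<alpha> * h 1 + (1 - \<alpha>) * h j)"
    using \<alpha> n N pos by (intro sum_nonneg add_nonneg_nonneg mult_nonneg_nonneg)
      (auto intro!: less_imp_le[OF pos] simp: subset_eq)
  then have \<mu>: "0 \<le> \<mu>"
    using eig[of 1] pos[of 1] n by (simp add: zero_le_mult_iff)
  define v where "v = vec n (\<lambda>j. complex_of_real (h (Suc j)))"
  have "?A *\<^sub>v v = complex_of_real \<mu> \<cdot>\<^sub>v v"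
  proof (rule eq_vecI)
    fix i assume "i < dim_vec (complex_of_real \<mu> \<cdot>\<^sub>v v)"
    then have i: "i < n" by (simp add: v_def)
    have "(?A *\<^sub>v v) $ i =
      complex_of_real (\<Sum>j | (Suc i, j) \<in> parcs G. \<alpha> * h (Suc i) + (1 - \<alpha>) * h j)"
      unfolding v_def by (subst A_alpha_mult_vec_index[OF G V i]) simp
    also have "\<dots> = complex_of_real (\<mu> * h (Suc i))"
      using i by (subst eig) auto
    finally show "(?A *\<^sub>v v) $ i = (complex_of_real \<mu> \<cdot>\<^sub>v v) $ i"
      using i by (simp add: v_def)
  qed (use A in \<open>simp add: v_def\<close>)
  moreover have "v \<noteq> 0\<^sub>v n"
  proof
    assume "v = 0\<^sub>v n"
    then have "v $ 0 = 0" using n by simp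
    then show False using pos[of 1] n by (simp add: v_def)
  qed
  ultimately have "complex_of_real \<mu> \<in> spectrum ?A"
    using A by (auto simp: spectrum_def eigenvalue_def eigenvector_def v_def intro!: exI[of _ v])
  then have "norm (complex_of_real \<mu>) \<in> norm ` spectrum ?A" by (rule imageI)
  then have lower: "\<mu> \<le> spectral_radius ?A"
    using spectral_radius_mem_max(2)[OF A n] \<mu> by fastforce
  obtain e where e: "e \<in> spectrum ?A" "spectral_radius ?A = norm e"
    using spectral_radius_mem_max(1)[OF A n] by auto
  then obtain z where z: "z \<in> carrier_vec n" "z \<noteq> 0\<^sub>v n" "?A *\<^sub>v z = e \<cdot>\<^sub>v z"
    using A by (auto simp: spectrum_def eigenvalue_def eigenvector_def)
  define w where "w j = z $ (j - 1)" for j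
  have zw: "z = vec n (\<lambda>j. w (Suc j))"
    using z(1) by (intro eq_vecI) (auto simp: w_def)
  let ?R = "(\<lambda>i. norm (w i) / h i) ` {1..n}"
  define r where "r = Max ?R"
  have "?R \<noteq> {}" "finite ?R" using n by auto
  then have "r \<in> ?R" unfolding r_def by (intro Max_in)
  then obtain k where k: "k \<in> {1..n}" "r = norm (w k) / h k" by auto
  have r: "norm (w j) \<le> r * h j" if "j \<in> {1..n}" for j
  proof -
    have "norm (w j) / h j \<le> r"
      unfolding r_def using that by (intro Max_ge) auto
    then show ?thesis using pos[OF that] by (simp add: field_simps)
  qed
  \<comment> \<open>Positivity of the maximal quotient gives \<open>w k \<noteq> 0\<close>, which
    allows \<open>norm (w k)\<close> to be cancelled at the end.\<close>
  have rpos: "0 < r"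
  proof (rule ccontr)
    assume "\<not> 0 < r"
    have "w j = 0" if "j \<in> {1..n}" for j
    proof -
      have "r * h j \<le> 0" using \<open>\<not> 0 < r\<close> pos[OF that] by (simp add: mult_nonpos_nonneg)
      then show ?thesis using r[OF that] by (meson norm_le_zero_iff order_trans)
    qed
    then have "z = 0\<^sub>v n" unfolding zw by (intro eq_vecI) auto
    then show False using z(2) by contradiction
  qed
  obtain i where i: "k = Suc i" "i < n" using k(1) by (cases k) auto
  have "e * w k = (?A *\<^sub>v z) $ i"
    unfolding z(3) using i by (simp add: zw)
  also have "\<dots> = (\<Sum>j | (k, j) \<in> parcs G. of_real \<alpha> * w k + of_real (1 - \<alpha>) * w j)"
    unfolding zw i(1) by (rule A_alpha_mult_vec_index[OF G V i(2)])
  finally have "norm e * norm (w k) =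
      norm (\<Sum>j | (k, j) \<in> parcs G. of_real \<alpha> * w k + of_real (1 - \<alpha>) * w j)"
    by (metis norm_mult)
  also have "\<dots> \<le> (\<Sum>j | (k, j) \<in> parcs G. r * (\<alpha> * h k + (1 - \<alpha>) * h j))"
  proof (rule sum_norm_le)
    fix j assume "j \<in> {j. (k, j) \<in> parcs G}"
    then have j: "j \<in> {1..n}" using N by blast
    have "norm (of_real \<alpha> * w k + of_real (1 - \<alpha>) * w j)
        \<le> norm (of_real \<alpha> * w k) + norm (of_real (1 - \<alpha>) * w j)"
      by (rule norm_triangle_ineq)
    also have "\<dots> = \<alpha> * norm (w k) + (1 - \<alpha>) * norm (w j)"
      using \<alpha> by (simp only: norm_mult norm_of_real abs_of_nonneg diff_ge_0_iff_ge)
    also have "\<dots> \<le> \<alpha> * (r * h k) + (1 - \<alpha>) * (r * h j)"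
      using \<alpha> r[OF k(1)] r[OF j] by (intro add_mono mult_left_mono) auto
    finally show "norm (of_real \<alpha> * w k + of_real (1 - \<alpha>) * w j) \<le> r * (\<alpha> * h k + (1 - \<alpha>) * h j)"
      by (simp add: algebra_simps)
  qed
  also have "\<dots> = \<mu> * (r * h k)"
    using eig[OF k(1)] by (simp add: sum_distrib_left[symmetric])
  also have "r * h k = norm (w k)" using k pos[OF k(1)] by simp
  finally have "norm e * norm (w k) \<le> \<mu> * norm (w k)" .
  moreover have "0 < norm (w k)" using rpos k pos[OF k(1)] by (simp add: zero_less_divide_iff)
  ultimately have "norm e \<le> \<mu>" by simp
  then show ?thesis using lower e(2) by (simp add: lambda_alpha_def)
qed

section \<open>The characteristic function and its roots\<close>

text \<open>The characteristic equation of the matrix restricted to eigenvectors that are constant on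
  the part of size \<open>b\<close>, where the path of \<open>m\<close> inner vertices leaves the part of size \<open>a\<close>
  and enters the part of size \<open>b\<close>; denominators are cleared except for those in the factor
  picked up along the path.\<close>

definition path_char_fun :: "real \<Rightarrow> nat \<Rightarrow> nat \<Rightarrow> nat \<Rightarrow> real \<Rightarrow> real" where
  "path_char_fun \<alpha> m a b \<mu> =
     (\<mu> - \<alpha> * (real b + 1)) * ((\<mu> - \<alpha> * a) * (\<mu> - \<alpha> * b)
        - (1 - \<alpha>)\<^sup>2 * (a * b + ((1 - \<alpha>) / (\<mu> - \<alpha>)) ^ m))
     - (1 - \<alpha>)\<^sup>2 * \<alpha> * (b + ((1 - \<alpha>) / (\<mu> - \<alpha>)) ^ m)"

text \<open>This grouping isolates a cubic that vanishes at \<open>\<alpha> * a\<close> and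
  \<open>\<alpha> * (b + 1)\<close>. The subtracted part is the one produced by the eigenvalue
  equation on the part of size \<open>b\<close>.\<close>

lemma path_char_fun_alt:
  "path_char_fun \<alpha> m a b \<mu> =
     (\<mu> - \<alpha> * a) * (\<mu> - \<alpha> * b) * (\<mu> - \<alpha> * (real b + 1))
     - (1 - \<alpha>)\<^sup>2 * ((b + ((1 - \<alpha>) / (\<mu> - \<alpha>)) ^ m) * (\<mu> - \<alpha> * b)
         + (real a - 1) * b * (\<mu> - \<alpha> * (real b + 1)))"
  unfolding path_char_fun_def by (simp add: algebra_simps)

text \<open>For such \<open>\<mu>\<close> the path factor is at most 1, and each linear factor of
  the cubic dominates the matching off-diagonal weight: \<open>(1 - \<alpha>) * (b + c)\<close>,
  \<open>(1 - \<alpha>) * b\<close> and, strictly, \<open>(1 - \<alpha>) * a\<close>.\<close>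

lemma path_char_fun_pos:
  assumes \<alpha>: "0 \<le> \<alpha>" "\<alpha> < 1" and ab: "1 \<le> a" "1 \<le> b" and \<mu>: "real a + b + 1 \<le> \<mu>"
  shows "0 < path_char_fun \<alpha> m a b \<mu>"
proof -
  define c where "c = ((1 - \<alpha>) / (\<mu> - \<alpha>)) ^ m"
  have sc: "\<alpha> * x \<le> x" if "0 \<le> x" for x :: real
    using that \<alpha> by (simp add: mult_left_le_one_le)
  have pos: "0 < \<mu> - \<alpha> * b" "0 < \<mu> - \<alpha> * (real b + 1)" "0 < \<mu> - \<alpha> * a"
    using sc[OF of_nat_0_le_iff, of a] sc[OF of_nat_0_le_iff, of b] \<alpha> \<mu> ab
    unfolding distrib_left by linarith+
  have c1: "c \<le> 1" unfolding c_def
    using \<alpha> \<mu> by (intro power_le_one) (auto simp: field_simps)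
  have "(1 - \<alpha>) * (b + c) \<le> (1 - \<alpha>) * (real b + 1)"
    using \<alpha> c1 by (intro mult_left_mono) auto
  also have "\<dots> \<le> \<mu> - \<alpha> * (real b + 1)"
    using \<mu> by (simp add: algebra_simps)
  finally have 1: "(1 - \<alpha>) * (b + c) \<le> \<mu> - \<alpha> * (real b + 1)" .
  have 2: "(1 - \<alpha>) * b \<le> \<mu> - \<alpha> * b"
    using \<mu> by (simp add: algebra_simps)
  have "(1 - \<alpha>)\<^sup>2 * ((b + c) * (\<mu> - \<alpha> * b) + (real a - 1) * b * (\<mu> - \<alpha> * (real b + 1)))
      = (1 - \<alpha>) * (((1 - \<alpha>) * (b + c)) * (\<mu> - \<alpha> * b)
          + (real a - 1) * (((1 - \<alpha>) * b) * (\<mu> - \<alpha> * (real b + 1))))"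
    by (simp add: algebra_simps power2_eq_square)
  also have "\<dots> \<le> (1 - \<alpha>) * ((\<mu> - \<alpha> * (real b + 1)) * (\<mu> - \<alpha> * b)
          + (real a - 1) * ((\<mu> - \<alpha> * b) * (\<mu> - \<alpha> * (real b + 1))))"
    using \<alpha> ab pos 1 2
    by (intro mult_left_mono add_mono mult_right_mono) auto
  also have "\<dots> = ((1 - \<alpha>) * a) * ((\<mu> - \<alpha> * b) * (\<mu> - \<alpha> * (real b + 1)))"
    by (simp add: algebra_simps)
  also have "\<dots> < (\<mu> - \<alpha> * a) * ((\<mu> - \<alpha> * b) * (\<mu> - \<alpha> * (real b + 1)))"
    using pos \<mu> by (intro mult_strict_right_mono mult_pos_pos) (auto simp: algebra_simps)
  finally show ?thesis
    unfolding path_char_fun_alt c_def[symmetric] by (simp add: algebra_simps)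
qed

text \<open>Intermediate value theorem between \<open>L\<close> and a point where the function is
  positive; \<open>\<alpha> < L\<close> keeps the interval away from the pole of the path
  factor.\<close>

lemma path_char_fun_root_above:
  assumes \<alpha>: "0 \<le> \<alpha>" "\<alpha> < 1" and ab: "1 \<le> a" "1 \<le> b"
    and L: "\<alpha> < L" "path_char_fun \<alpha> m a b L < 0"
  obtains \<mu> where "L < \<mu>" "path_char_fun \<alpha> m a b \<mu> = 0"
proof -
  define U where "U = max L (real a + b + 1)"
  have U: "0 < path_char_fun \<alpha> m a b U"
    unfolding U_def using \<alpha> ab by (intro path_char_fun_pos) auto
  have "continuous_on {L..U} (path_char_fun \<alpha> m a b)"
    unfolding path_char_fun_def using L(1) by (intro continuous_intros) auto
  then obtain \<mu> where \<mu>: "L \<le> \<mu>" "\<mu> \<le> U" "path_char_fun \<alpha> m a b \<mu> = 0"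
    using IVT'[of "path_char_fun \<alpha> m a b" L 0 U] L(2) U
    by (metis U_def less_imp_le max.cobounded1)
  with L(2) have "L \<noteq> \<mu>" by auto
  with \<mu> that show ?thesis by force
qed

text \<open>The lower bounds place \<open>\<mu>\<close> above every diagonal entry of the matrix.
  This makes the explicit eigenvector positive and so singles out the root that is the spectral
  radius.\<close>

definition admissible_root :: "real \<Rightarrow> nat \<Rightarrow> nat \<Rightarrow> nat \<Rightarrow> real \<Rightarrow> bool" where
  "admissible_root \<alpha> m a b \<mu> \<longleftrightarrow> 0 < \<mu> \<and> \<alpha> * a < \<mu> \<and> \<alpha> * (real b + 1) < \<mu> \<and>
     path_char_fun \<alpha> m a b \<mu> = 0"

lemma admissible_root_exists:
  assumes \<alpha>: "0 \<le> \<alpha>" "\<alpha> < 1" and ab: "1 \<le> a" "1 \<le> b"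
  obtains \<mu> where "admissible_root \<alpha> m a b \<mu>"
proof (cases "\<alpha> = 0")
  case True
  \<comment> \<open>For \<open>\<alpha> = 0\<close> all diagonal entries coincide with the pole at
    0, so the search starts at 1, where the path factor is 1 and the function equals
    \<open>- a * b\<close>.\<close>
  have "1 \<le> a * b" using ab by simp
  then have "1 \<le> real a * real b" by (metis of_nat_1 of_nat_le_iff of_nat_mult)
  then have "path_char_fun \<alpha> m a b 1 < 0"
    by (simp add: path_char_fun_def True)
  then obtain \<mu> where "1 < \<mu>" "path_char_fun \<alpha> m a b \<mu> = 0"
    using path_char_fun_root_above[OF \<alpha> ab] \<alpha> by blast
  then show ?thesis using that[of \<mu>] True by (simp add: admissible_root_def)
next
  case False
  then have \<alpha>0: "0 < \<alpha>" using \<alpha> by simp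
  \<comment> \<open>The largest diagonal entry: the cubic vanishes there while the subtracted part
    is positive.\<close>
  define M where "M = max (\<alpha> * a) (\<alpha> * (real b + 1))"
  have M: "\<alpha> * b < M" "\<alpha> < M" "\<alpha> * (real b + 1) \<le> M" "\<alpha> * a \<le> M"
    using \<alpha>0 ab unfolding M_def by (auto simp: less_max_iff_disj)
  have "0 \<le> ((1 - \<alpha>) / (M - \<alpha>)) ^ m"
    using \<alpha> M by (intro zero_le_power) auto
  then have "0 < (b + ((1 - \<alpha>) / (M - \<alpha>)) ^ m) * (M - \<alpha> * b)"
    using M ab by (intro mult_pos_pos) auto
  moreover have "0 \<le> (real a - 1) * b * (M - \<alpha> * (real b + 1))"
    using M ab by (intro mult_nonneg_nonneg) auto
  ultimately have "0 < (1 - \<alpha>)\<^sup>2 * ((b + ((1 - \<alpha>) / (M - \<alpha>)) ^ m) * (M - \<alpha> * b)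
         + (real a - 1) * b * (M - \<alpha> * (real b + 1)))"
    using \<alpha> by (intro mult_pos_pos) auto
  moreover have "(M - \<alpha> * a) * (M - \<alpha> * b) * (M - \<alpha> * (real b + 1)) = 0"
    unfolding M_def by (auto simp: max_def)
  ultimately have "path_char_fun \<alpha> m a b M < 0"
    unfolding path_char_fun_alt by linarith
  then obtain \<mu> where "M < \<mu>" "path_char_fun \<alpha> m a b \<mu> = 0"
    using path_char_fun_root_above[OF \<alpha> ab M(2)] by blast
  then show ?thesis using that[of \<mu>] M \<alpha> by (simp add: admissible_root_def)
qed

section \<open>Comparison under exchange of the two parts\<close>

text \<open>The factor \<open>S\<close> is symmetric in \<open>p\<close> and \<open>q\<close>, and
  the root equation forces it to be positive. Exchanging the parts shrinks the factor in front of
  \<open>S\<close> and enlarges the subtracted term.\<close>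

lemma path_char_fun_swap_neg:
  assumes \<alpha>: "0 < \<alpha>" "\<alpha> < 1" and pq: "q < p" and \<mu>: "\<alpha> * (real p + 1) < \<mu>"
    and root: "path_char_fun \<alpha> m p q \<mu> = 0"
  shows "path_char_fun \<alpha> m q p \<mu> < 0"
proof -
  define c where "c = ((1 - \<alpha>) / (\<mu> - \<alpha>)) ^ m"
  define S where "S = (\<mu> - \<alpha> * p) * (\<mu> - \<alpha> * q) - (1 - \<alpha>)\<^sup>2 * (p * q + c)"
  have "\<alpha> \<le> \<alpha> * (real p + 1)" using \<alpha> by simp
  then have "\<alpha> < \<mu>" using \<mu> by linarith
  then have c: "0 < c" unfolding c_def using \<alpha> by simp
  have lt: "\<mu> - \<alpha> * (real p + 1) < \<mu> - \<alpha> * (real q + 1)" using \<alpha> pq by simp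
  have eq: "(\<mu> - \<alpha> * (real q + 1)) * S = (1 - \<alpha>)\<^sup>2 * \<alpha> * (q + c)"
    using root unfolding path_char_fun_def c_def[symmetric] S_def by simp
  moreover have "0 < (1 - \<alpha>)\<^sup>2 * \<alpha> * (q + c)" using \<alpha> c by simp
  ultimately have "0 < S"
    using lt \<mu> by (metis diff_gt_0_iff_gt less_trans zero_less_mult_pos)
  then have "(\<mu> - \<alpha> * (real p + 1)) * S < (1 - \<alpha>)\<^sup>2 * \<alpha> * (q + c)"
    unfolding eq[symmetric] using lt by (intro mult_strict_right_mono)
  also have "\<dots> \<le> (1 - \<alpha>)\<^sup>2 * \<alpha> * (p + c)"
    using \<alpha> pq by (intro mult_left_mono) auto
  finally show ?thesis
    unfolding path_char_fun_def c_def[symmetric] S_def by (simp add: algebra_simps)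
qed

text \<open>If \<open>\<mu>\<close> exceeds \<open>\<alpha> * (p + 1)\<close>, the exchanged
  function is negative at \<open>\<mu>\<close> and has a root beyond it. Otherwise every admissible
  root of the exchanged function already lies above \<open>\<mu>\<close>.\<close>

lemma admissible_root_swap:
  assumes \<alpha>: "0 < \<alpha>" "\<alpha> < 1" and q: "1 \<le> q" "q < p" and \<mu>: "admissible_root \<alpha> m p q \<mu>"
  obtains \<nu> where "\<mu> < \<nu>" "admissible_root \<alpha> m q p \<nu>"
proof (cases "\<alpha> * (real p + 1) < \<mu>")
  case True
  have neg: "path_char_fun \<alpha> m q p \<mu> < 0"
    using path_char_fun_swap_neg[OF \<alpha> q(2) True] \<mu> by (simp add: admissible_root_def)
  have "\<alpha> \<le> \<alpha> * (real p + 1)" "\<alpha> * q \<le> \<alpha> * (real p + 1)" using \<alpha> q by auto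
  then have low: "\<alpha> < \<mu>" "\<alpha> * q < \<mu>" using True by auto
  have "0 \<le> \<alpha>" "1 \<le> p" using \<alpha> q by auto
  then obtain \<nu> where "\<mu> < \<nu>" "path_char_fun \<alpha> m q p \<nu> = 0"
    using path_char_fun_root_above[OF _ \<alpha>(2) q(1) _ low(1) neg] by blast
  then show ?thesis
    using that[of \<nu>] True low \<mu> by (auto simp: admissible_root_def)
next
  case False
  have "0 \<le> \<alpha>" "1 \<le> p" using \<alpha> q by auto
  then obtain \<nu> where "admissible_root \<alpha> m q p \<nu>"
    using admissible_root_exists[OF _ \<alpha>(2) q(1)] by blast
  then show ?thesis using that[of \<nu>] False by (auto simp: admissible_root_def)
qed

section \<open>The explicit positive eigenvector\<close>

text \<open>Naming the parts by the direction of the path (out of \<open>U\<close>, into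
  \<open>W\<close>) covers both digraphs at once.\<close>

lemma lambda_alpha_bipartite_with_path:
  fixes U W :: "nat set"
  assumes G: "pair_digraph G" and V: "pverts G = {1..n}"
    and arcs: "parcs G = U \<times> W \<union> W \<times> U \<union>
      insert (u, r + 1) (insert (n, w) ((\<lambda>i. (i, i + 1)) ` {r + 1..<n}))"
    and UW: "U \<union> W = {1..r}" "U \<inter> W = {}" "u \<in> U" "w \<in> W" and r: "r < n"
    and \<alpha>: "0 \<le> \<alpha>" "\<alpha> < 1"
    and root: "admissible_root \<alpha> (n - r) (card U) (card W) \<mu>"
  shows "lambda_alpha \<alpha> G = \<mu>"
proof -
  define a b where "a = card U" and "b = card W"
  \<comment> \<open>With the value 1 on \<open>W\<close>, the numbers \<open>t\<close>,
    \<open>x\<close> and \<open>x1\<close> solve the eigenvalue equations on the path, on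
    \<open>U - {u}\<close> and at \<open>u\<close>.\<close>
  define t where "t = (1 - \<alpha>) / (\<mu> - \<alpha>)"
  define x where "x = (1 - \<alpha>) * b / (\<mu> - \<alpha> * b)"
  define x1 where "x1 = (1 - \<alpha>) * (b + t ^ (n - r)) / (\<mu> - \<alpha> * (real b + 1))"
  \<comment> \<open>The exponent counts the steps left to \<open>w\<close>: vertex \<open>n\<close>
    gets \<open>t\<close>, and the first inner vertex \<open>r + 1\<close> gets
    \<open>t ^ (n - r)\<close>, the term occurring in \<open>x1\<close>.\<close>
  define h where "h i = (if i = u then x1 else if i \<in> U then x else if i \<in> W then 1
    else t ^ (n + 1 - i))" for i
  have fin: "finite U" "finite W"
    using UW(1) by (metis finite_Un finite_atLeastAtMost)+
  have ab: "1 \<le> a" "1 \<le> b"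
    unfolding a_def b_def using fin UW by (auto simp: Suc_le_eq card_gt_0_iff)
  have \<mu>: "0 < \<mu>" "\<alpha> * a < \<mu>" "\<alpha> * (real b + 1) < \<mu>" "path_char_fun \<alpha> (n - r) a b \<mu> = 0"
    using root by (auto simp: admissible_root_def a_def b_def)
  have "\<alpha> * 1 \<le> \<alpha> * (real b + 1)" "\<alpha> * b \<le> \<alpha> * (real b + 1)"
    using \<alpha> by (intro mult_left_mono; simp)+
  then have \<mu>b: "\<alpha> < \<mu>" "\<alpha> * b < \<mu>" using \<mu> by auto
  have t: "0 < t" unfolding t_def using \<alpha> \<mu>b by simp
  have x: "0 < x" unfolding x_def using \<alpha> \<mu>b ab by simp
  have x1: "0 < x1" unfolding x1_def using \<alpha> \<mu> ab t
    by (intro divide_pos_pos mult_pos_pos) (auto intro: add_pos_pos)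
  have xeq: "(\<mu> - \<alpha> * b) * x = (1 - \<alpha>) * b" unfolding x_def using \<mu>b by simp
  have x1eq: "(\<mu> - \<alpha> * (real b + 1)) * x1 = (1 - \<alpha>) * (b + t ^ (n - r))"
    unfolding x1_def using \<mu> by simp
  have teq: "(\<mu> - \<alpha>) * t = 1 - \<alpha>" unfolding t_def using \<mu>b by simp
  \<comment> \<open>The remaining equation, at the vertices of \<open>W\<close>, is the vanishing of
    the characteristic function divided by two positive factors.\<close>
  have Weq: "(1 - \<alpha>) * (x1 + (real a - 1) * x) = \<mu> - \<alpha> * a"
  proof -
    have "(\<mu> - \<alpha> * a) * ((\<mu> - \<alpha> * b) * (\<mu> - \<alpha> * (real b + 1))) =
      (1 - \<alpha>) * ((1 - \<alpha>) * (b + t ^ (n - r)) * (\<mu> - \<alpha> * b)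
        + (real a - 1) * ((1 - \<alpha>) * b) * (\<mu> - \<alpha> * (real b + 1)))"
      using \<mu>(4) unfolding path_char_fun_alt t_def[symmetric]
      by (simp add: algebra_simps power2_eq_square)
    also have "\<dots> = (1 - \<alpha>) * (x1 + (real a - 1) * x) * ((\<mu> - \<alpha> * b) * (\<mu> - \<alpha> * (real b + 1)))"
      unfolding xeq[symmetric] x1eq[symmetric] by (simp add: algebra_simps)
    finally show ?thesis using \<mu>b \<mu>(3) by simp
  qed
  have le: "i \<le> r \<and> 1 \<le> i" if "i \<in> U \<or> i \<in> W" for i using that UW(1) by auto
  have mem: "(i, j) \<in> parcs G \<longleftrightarrow> i \<in> U \<and> j \<in> W \<or> i \<in> W \<and> j \<in> U \<or> i = u \<and> j = r + 1
      \<or> i = n \<and> j = w \<or> r < i \<and> i < n \<and> j = i + 1" for i j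
    unfolding arcs by (simp add: image_iff Suc_le_eq) blast
  have disj: "i \<notin> W \<and> \<not> r < i \<and> i \<noteq> n" if "i \<in> U" for i
    using that UW(2) le[of i] r by auto
  have disj': "i \<notin> U \<and> \<not> r < i \<and> i \<noteq> n \<and> i \<noteq> u" if "i \<in> W" for i
    using that UW(2,3) le[of i] r by auto
  have path: "i \<notin> U \<and> i \<notin> W \<and> i \<noteq> u" if "r < i" for i
    using that UW(3) le[of i] le[of u] by auto
  have hU: "h i = x" if "i \<in> U - {u}" for i using that by (auto simp: h_def)
  have hu: "h u = x1" by (simp add: h_def)
  have hW: "h i = 1" if "i \<in> W" for i using that UW by (auto simp: h_def)
  have hP: "h i = t ^ (n + 1 - i)" if "r < i" for i
    using that le[of i] le[of u] UW(3) by (auto simp: h_def)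
  have sumW: "(\<Sum>j\<in>W. A + B * h j) = b * (A + B)" for A B :: real
  proof -
    have "(\<Sum>j\<in>W. A + B * h j) = (\<Sum>j\<in>W. A + B)" by (intro sum.cong) (auto simp: hW)
    then show ?thesis by (simp add: b_def)
  qed
  show ?thesis
  proof (rule lambda_alpha_eqI[OF G V])
    show "0 < n" using r by simp
    show "0 < h i" if "i \<in> {1..n}" for i using x x1 t by (auto simp: h_def)
    fix i assume i: "i \<in> {1..n}"
    let ?N = "{j. (i, j) \<in> parcs G}"
    consider "i = u" | "i \<in> U - {u}" | "i \<in> W" | "r < i" "i < n" | "i = n"
      using i UW(1) by (cases "i \<le> r") force+
    then show "(\<Sum>j\<in>?N. \<alpha> * h i + (1 - \<alpha>) * h j) = \<mu> * h i"
    proof cases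
      case 1
      have "?N = insert (r + 1) W" using disj[OF UW(3)] UW(3) by (auto simp: 1 mem)
      moreover have "r + 1 \<notin> W" using le[of "r + 1"] by auto
      ultimately have "(\<Sum>j\<in>?N. \<alpha> * h i + (1 - \<alpha>) * h j)
          = (\<alpha> * h i + (1 - \<alpha>) * h (r + 1)) + (\<Sum>j\<in>W. \<alpha> * h i + (1 - \<alpha>) * h j)"
        using fin by (simp add: distrib_right)
      also have "\<dots> = \<alpha> * (real b + 1) * x1 + (1 - \<alpha>) * (b + t ^ (n - r))"
        unfolding sumW 1 hu by (simp add: hP algebra_simps)
      finally show ?thesis unfolding x1eq[symmetric] 1 hu by (simp add: algebra_simps)
    next
      case 2
      have "?N = W" using 2 disj[of i] by (simp add: mem)
      then have "(\<Sum>j\<in>?N. \<alpha> * h i + (1 - \<alpha>) * h j) = \<alpha> * b * x + (1 - \<alpha>) * b"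
        by (simp add: sumW hU[OF 2]) (simp add: algebra_simps)
      then show ?thesis unfolding xeq[symmetric] hU[OF 2] by (simp add: algebra_simps)
    next
      case 3
      have "?N = U" using 3 disj'[of i] by (simp add: mem)
      then have "(\<Sum>j\<in>?N. \<alpha> * h i + (1 - \<alpha>) * h j)
          = (\<alpha> + (1 - \<alpha>) * x1) + (\<Sum>j\<in>U - {u}. \<alpha> * h i + (1 - \<alpha>) * h j)"
        using sum.remove[OF fin(1) UW(3), of "\<lambda>j. \<alpha> * h i + (1 - \<alpha>) * h j"]
        by (simp only: hu hW[OF 3] mult_1_right)
      also have "(\<Sum>j\<in>U - {u}. \<alpha> * h i + (1 - \<alpha>) * h j) = (\<Sum>j\<in>U - {u}. \<alpha> + (1 - \<alpha>) * x)"
        by (intro sum.cong) (simp_all add: hU hW[OF 3])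
      also have "\<dots> = (real a - 1) * (\<alpha> + (1 - \<alpha>) * x)"
        using fin UW(3) ab by (simp add: a_def of_nat_diff)
      finally show ?thesis using Weq by (simp add: hW[OF 3] algebra_simps)
    next
      case 4
      have "?N = {i + 1}" using 4 path[of i] by (simp add: mem)
      moreover have "n + 1 - i = Suc (n - i)" using 4 by simp
      ultimately have "(\<Sum>j\<in>?N. \<alpha> * h i + (1 - \<alpha>) * h j)
          = (\<alpha> * t + (1 - \<alpha>)) * t ^ (n - i)"
        using 4 by (simp add: hP algebra_simps)
      also have "\<dots> = \<mu> * (t * t ^ (n - i))" unfolding teq[symmetric] by (simp add: algebra_simps)
      finally show ?thesis using 4 \<open>n + 1 - i = Suc (n - i)\<close> by (simp add: hP)
    next
      case 5
      have "?N = {w}" using path[OF r] by (simp add: 5 mem)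
      then show ?thesis using 5 r UW(4) teq by (simp add: hP hW algebra_simps)
    qed
  qed (use \<alpha> in auto)
qed

section \<open>The two digraphs and the conclusion\<close>

lemma set_vwalk_arcs_upt:
  assumes "r < n"
  shows "set (vwalk_arcs ([u] @ [r + 1..<n + 1] @ [w])) =
    insert (u, r + 1) (insert (n, w) ((\<lambda>i. (i, i + 1)) ` {r + 1..<n}))"
proof -
  have "set (vwalk_arcs [r + 1..<n + 1]) = (\<lambda>i. (i, i + 1)) ` {r + 1..<n}"
    using assms
  proof (induction n)
    case (Suc n)
    show ?case
    proof (cases "r < n")
      case True
      have "[r + 1..<Suc n + 1] = [r + 1..<n + 1] @ [n + 1]" using True by simp
      then have "set (vwalk_arcs [r + 1..<Suc n + 1]) =
          insert (n, n + 1) (set (vwalk_arcs [r + 1..<n + 1]))"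
        using True by (simp add: set_vwalk_arcs_snoc del: upt_Suc)
      also have "\<dots> = (\<lambda>i. (i, i + 1)) ` {r + 1..<Suc n}"
        using Suc.IH[OF True] True by (simp add: atLeastLessThanSuc)
      finally show ?thesis .
    next
      case False
      \<comment> \<open>Here the list has the single vertex \<open>n + 1\<close>, hence no
        arcs.\<close>
      then have "r = n" using Suc.prems by simp
      then show ?thesis by simp
    qed
  qed simp
  moreover have "hd ([r + 1..<n + 1] @ [w]) = r + 1" "last [r + 1..<n + 1] = n"
    using assms by (simp_all add: hd_append)
  ultimately show ?thesis
    using assms by (simp add: set_vwalk_arcs_snoc del: upt_Suc)
qed

text \<open>The path leaves \<open>{1..p}\<close> in \<open>B5\<close> and
  \<open>{p + 1..p + q}\<close> in \<open>B6\<close>, so the roles of \<open>U\<close> and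
  \<open>W\<close>, and with them \<open>p\<close> and \<open>q\<close>, are exchanged.\<close>

lemma
  assumes \<alpha>: "0 \<le> \<alpha>" "\<alpha> < 1" and pq: "1 \<le> p" "1 \<le> q" "p + q < n"
  shows lambda_alpha_B5:
      "admissible_root \<alpha> (n - (p + q)) p q \<mu> \<Longrightarrow> lambda_alpha \<alpha> (B5 n p q) = \<mu>"
    and lambda_alpha_B6:
      "admissible_root \<alpha> (n - (p + q)) q p \<mu> \<Longrightarrow> lambda_alpha \<alpha> (B6 n p q) = \<mu>"
proof -
  let ?P = "{1..p}" and ?Q = "{p + 1..p + q}"
  have parts: "?P \<union> ?Q = {1..p + q}" "?P \<inter> ?Q = {}" "1 \<in> ?P" "p + 1 \<in> ?Q"
    using pq by auto
  have verts: "pverts (B5 n p q) = {1..n}" "pverts (B6 n p q) = {1..n}"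
    using pq by (simp_all add: pverts_B5 pverts_B6)
  have arcs5: "parcs (B5 n p q) = ?P \<times> ?Q \<union> ?Q \<times> ?P \<union>
      insert (1, p + q + 1) (insert (n, p + 1) ((\<lambda>i. (i, i + 1)) ` {p + q + 1..<n}))"
    unfolding B5_def add_directed_path_def complete_bipartite_digraph_def
      set_vwalk_arcs_upt[OF pq(3)] by simp
  have arcs6: "parcs (B6 n p q) = ?Q \<times> ?P \<union> ?P \<times> ?Q \<union>
      insert (p + 1, p + q + 1) (insert (n, 1) ((\<lambda>i. (i, i + 1)) ` {p + q + 1..<n}))"
    unfolding B6_def add_directed_path_def complete_bipartite_digraph_def
      set_vwalk_arcs_upt[OF pq(3)] by (simp add: Un_commute)
  show "lambda_alpha \<alpha> (B5 n p q) = \<mu>" if "admissible_root \<alpha> (n - (p + q)) p q \<mu>"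
    using lambda_alpha_bipartite_with_path[OF pair_digraph_B5[OF pq(1,2)] verts(1) arcs5 parts pq(3) \<alpha>]
      that by simp
  show "lambda_alpha \<alpha> (B6 n p q) = \<mu>" if "admissible_root \<alpha> (n - (p + q)) q p \<mu>"
    using lambda_alpha_bipartite_with_path[OF pair_digraph_B6[OF pq(1,2)] verts(2) arcs6 _ _
        parts(4,3) pq(3) \<alpha>] parts(1,2) that by (simp add: Un_commute Int_commute)
qed

theorem theorem4p4:
  fixes \<alpha> :: real and n p q :: nat
  assumes "0 \<le> \<alpha>" and "\<alpha> < 1" and "p \<ge> q" and "q \<ge> 2" and "p + q \<le> n - 1"
  shows "lambda_alpha \<alpha> (B6 n p q) \<ge> lambda_alpha \<alpha> (B5 n p q) \<and>
    (lambda_alpha \<alpha> (B6 n p q) = lambda_alpha \<alpha> (B5 n p q) \<longleftrightarrow> p = q \<or> \<alpha> = 0)"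
proof -
  define m where "m = n - (p + q)"
  have pq: "1 \<le> p" "1 \<le> q" "p + q < n" using assms by auto
  note B5 = lambda_alpha_B5[OF assms(1,2) pq, folded m_def]
  note B6 = lambda_alpha_B6[OF assms(1,2) pq, folded m_def]
  obtain \<mu> where \<mu>: "admissible_root \<alpha> m p q \<mu>"
    using admissible_root_exists[OF assms(1,2) pq(1,2)] .
  show ?thesis
  proof (cases "p = q \<or> \<alpha> = 0")
    case True
    \<comment> \<open>For \<open>\<alpha> = 0\<close> the last term vanishes and the rest is
      symmetric in the two parts, so both digraphs share the root.\<close>
    then have "admissible_root \<alpha> m q p \<mu>"
      using \<mu> by (auto simp: admissible_root_def path_char_fun_def algebra_simps)
    then show ?thesis using B5[OF \<mu>] B6 True by auto
  next
    case False
    then have *: "q < p" "0 < \<alpha>" using assms by auto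
    obtain \<nu> where "\<mu> < \<nu>" "admissible_root \<alpha> m q p \<nu>"
      using admissible_root_swap[OF *(2) assms(2) pq(2) *(1) \<mu>] .
    then show ?thesis using B5[OF \<mu>] B6 False by auto
  qed
qed

end
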